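(* Let $G$ be a finite simple graph that is $(P_3\cup P_2, K_4)$-free, i.e. $G$ has no induced subgraph isomorphic to $P_3\cup P_2$ and no induced subgraph isomorphic to $K_4$. Then $\chi(G)\le 9$.
   Context: All graphs are finite and simple. $\chi(G)$ is the chromatic number of $G$. $P_k$ denotes the path on $k$ vertices and $K_n$ the complete graph on $n$ vertices. For vertex-disjoint graphs $A,B$, the union $A\cup B$ is their disjoint union; thus $P_3\cup P_2$ has 5 vertices $a,b,c,d,e$ and exactly the edges $ab,bc,de$. *)

theory Defs
  imports "Graph_Theory.Graph_Theory"
begin

text \<open>
  Finite simple graphs are the locale \<open>graph\<close> of \<open>Graph_Theory\<close>: finite loop-free digraphs
  without parallel arcs whose arc relation is symmetric. An undirected edge \<open>uv\<close> is thus the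
  pair of arcs \<open>u \<rightarrow> v\<close> and \<open>v \<rightarrow> u\<close>. The null graph is allowed.
\<close>

definition path_graph :: "nat \<Rightarrow> nat pair_pre_digraph" where
  "path_graph k = \<lparr> pverts = {..<k},
     parcs = {(i, j). i < k \<and> j < k \<and> (j = Suc i \<or> i = Suc j)} \<rparr>"

text \<open>
  \<open>Graph_Theory\<close>'s \<open>complete_digraph n\<close> is a predicate on graphs; this is its standard
  representative, see \<open>complete_digraph_complete_graph\<close> below.
\<close>
definition complete_graph :: "nat \<Rightarrow> nat pair_pre_digraph" where
  "complete_graph n = \<lparr> pverts = {..<n}, parcs = {(i, j). i < n \<and> j < n \<and> i \<noteq> j} \<rparr>"

definition disjoint_union ::
    "'a pair_pre_digraph \<Rightarrow> 'b pair_pre_digraph \<Rightarrow> ('a + 'b) pair_pre_digraph" where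
  "disjoint_union A B = \<lparr> pverts = pverts A <+> pverts B,
     parcs = map_prod Inl Inl ` parcs A \<union> map_prod Inr Inr ` parcs B \<rparr>"

definition induced_free :: "('a, 'b) pre_digraph \<Rightarrow> ('c, 'd) pre_digraph \<Rightarrow> bool" where
  "induced_free G H \<longleftrightarrow> \<not> (\<exists>S. induced_subgraph S G \<and> digraph_iso S H)"

definition proper_coloring :: "('a, 'b) pre_digraph \<Rightarrow> nat \<Rightarrow> ('a \<Rightarrow> nat) \<Rightarrow> bool" where
  "proper_coloring G k c \<longleftrightarrow>
     (\<forall>v \<in> verts G. c v < k) \<and> (\<forall>u v. u \<rightarrow>\<^bsub>G\<^esub> v \<longrightarrow> c u \<noteq> c v)"

text \<open>
  \<open>LEAST\<close> is unspecified on an empty set of candidates; \<open>chromatic_number_attained\<close> below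
  shows that this does not happen for finite simple graphs.
\<close>
definition chromatic_number :: "('a, 'b) pre_digraph \<Rightarrow> nat" where
  "chromatic_number G = (LEAST k. \<exists>c. proper_coloring G k c)"

lemma pair_graph_path_graph: "pair_graph (path_graph k)"
proof unfold_locales
  show "finite (parcs (path_graph k))"
    by (rule finite_subset[of _ "{..<k} \<times> {..<k}"]) (auto simp: path_graph_def)
qed (auto simp: path_graph_def symmetric_def sym_def arcs_ends_conv)

lemma pair_graph_complete_graph: "pair_graph (complete_graph n)"
proof unfold_locales
  show "finite (parcs (complete_graph n))"
    by (rule finite_subset[of _ "{..<n} \<times> {..<n}"]) (auto simp: complete_graph_def)
qed (auto simp: complete_graph_def symmetric_def sym_def arcs_ends_conv)

lemma complete_digraph_complete_graph: "complete_digraph n (with_proj (complete_graph n))"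
  unfolding complete_digraph_def
  using pair_graph.pair_graphD_graph[OF pair_graph_complete_graph]
  by (auto simp: complete_graph_def arcs_ends_conv)

lemma pair_graph_disjoint_union:
  assumes "pair_graph A" "pair_graph B"
  shows "pair_graph (disjoint_union A B)"
proof -
  interpret A: pair_graph A by fact
  interpret B: pair_graph B by fact
  have symA: "(u, v) \<in> parcs A \<Longrightarrow> (v, u) \<in> parcs A" for u v
    using A.pair_sym_arcs by (force simp: symmetric_def sym_def arcs_ends_conv)
  have symB: "(u, v) \<in> parcs B \<Longrightarrow> (v, u) \<in> parcs B" for u v
    using B.pair_sym_arcs by (force simp: symmetric_def sym_def arcs_ends_conv)
  have sym: "sym (parcs (disjoint_union A B))"
    by (rule symI) (force simp: disjoint_union_def dest: symA symB)
  show ?thesis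
    by unfold_locales
      (use sym in \<open>auto simp: disjoint_union_def symmetric_def arcs_ends_conv
        dest: A.wellformed B.wellformed A.no_loops B.no_loops\<close>)
qed

text \<open>
  \<open>digraph_iso\<close> maps arcs as well as vertices; between simple graphs this amounts to an
  injection of the vertices that preserves and reflects adjacency.
\<close>
lemma induced_free_iff:
  assumes "graph G" "pair_graph H"
  shows "induced_free G (with_proj H) \<longleftrightarrow>
    \<not> (\<exists>f. inj_on f (pverts H) \<and> f ` pverts H \<subseteq> verts G \<and>
        (\<forall>u \<in> pverts H. \<forall>v \<in> pverts H. (u, v) \<in> parcs H \<longleftrightarrow> f u \<rightarrow>\<^bsub>G\<^esub> f v))"
    (is "_ \<longleftrightarrow> \<not> ?R")
proof -
  interpret G: graph G by fact
  interpret H: pair_graph H by fact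
  have 1: "?R" if S: "induced_subgraph S G" "digraph_iso S (with_proj H)" for S
  proof -
    from S(1) have SG: "verts S \<subseteq> verts G" "tail S = tail G" "head S = head G"
      and arcsS: "arcs S = {e \<in> arcs G. tail G e \<in> verts S \<and> head G e \<in> verts S}"
      by (auto simp: induced_subgraph_def subgraph_def compatible_def)
    from S(2) obtain h where h: "pre_digraph.digraph_isomorphism S h" and H: "with_proj H = app_iso h S"
      by (auto simp: digraph_iso_def)
    define g where "g = iso_verts h"
    have inj: "inj_on g (verts S)"
      and ends: "\<And>a. a \<in> arcs S \<Longrightarrow> iso_arcs h a = (g (tail G a), g (head G a))"
      using h arg_cong[OF H, of tail] arg_cong[OF H, of head] SG
      by (auto simp: pre_digraph.digraph_isomorphism_def g_def app_iso_def prod_eq_iff)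
    have vH: "pverts H = g ` verts S" and aH: "parcs H = iso_arcs h ` arcs S"
      using arg_cong[OF H, of verts] arg_cong[OF H, of arcs] by (auto simp: app_iso_def g_def)
    define f where "f = the_inv_into (verts S) g"
    have fg: "f (g x) = x" if "x \<in> verts S" for x
      using that inj by (simp add: f_def the_inv_into_f_f)
    have adj: "(g x, g y) \<in> parcs H \<longleftrightarrow> x \<rightarrow>\<^bsub>G\<^esub> y" if "x \<in> verts S" "y \<in> verts S" for x y
    proof
      assume "(g x, g y) \<in> parcs H"
      then obtain a where a: "a \<in> arcs S" "(g x, g y) = iso_arcs h a" by (auto simp: aH)
      then have "tail G a = x" "head G a = y" "a \<in> arcs G"
        using ends[OF a(1)] arcsS inj that by (auto dest: inj_onD)
      then show "x \<rightarrow>\<^bsub>G\<^esub> y" by (auto simp: arcs_ends_conv)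
    next
      assume "x \<rightarrow>\<^bsub>G\<^esub> y"
      then obtain a where a: "a \<in> arcs G" "tail G a = x" "head G a = y" by (rule reachableE)
      then have "a \<in> arcs S" using arcsS that by auto
      then show "(g x, g y) \<in> parcs H" using ends[of a] a by (force simp: aH)
    qed
    show ?R
    proof (intro exI[of _ f] conjI ballI)
      show "inj_on f (pverts H)" by (auto simp: vH inj_on_def fg)
      show "f ` pverts H \<subseteq> verts G" using SG by (auto simp: vH fg)
      show "(u, v) \<in> parcs H \<longleftrightarrow> f u \<rightarrow>\<^bsub>G\<^esub> f v" if "u \<in> pverts H" "v \<in> pverts H" for u v
        using that adj by (auto simp: vH fg)
    qed
  qed
  have 2: "\<exists>S. induced_subgraph S G \<and> digraph_iso S (with_proj H)"
    if inj: "inj_on f (pverts H)" and fV: "f ` pverts H \<subseteq> verts G"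
      and adj: "\<forall>u \<in> pverts H. \<forall>v \<in> pverts H. (u, v) \<in> parcs H \<longleftrightarrow> f u \<rightarrow>\<^bsub>G\<^esub> f v" for f
  proof -
    define S where "S = G \<restriction> (f ` pverts H)"
    have ind: "induced_subgraph S G"
      unfolding S_def using fV by (rule G.induced_induce)
    define g where "g = the_inv_into (pverts H) f"
    have gf: "g (f x) = x" if "x \<in> pverts H" for x
      using that inj by (simp add: g_def the_inv_into_f_f)
    define h where "h = \<lparr> iso_verts = g, iso_arcs = (\<lambda>a. (g (tail G a), g (head G a))),
      iso_head = snd, iso_tail = fst \<rparr>"
    have wf: "wf_digraph S" using ind by (auto simp: induced_subgraph_def subgraph_def)
    have sel: "verts S = f ` pverts H" "tail S = tail G" "head S = head G"
      "arcs S = {a \<in> arcs G. tail G a \<in> f ` pverts H \<and> head G a \<in> f ` pverts H}"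
      by (auto simp: S_def induce_subgraph_def)
    have ginj: "inj_on g (f ` pverts H)" by (auto simp: inj_on_def gf)
    have "pre_digraph.digraph_isomorphism S h"
      unfolding pre_digraph.digraph_isomorphism_def
    proof (intro conjI)
      show "inj_on (iso_arcs h) (arcs S)"
      proof (rule inj_onI)
        fix a b assume "a \<in> arcs S" "b \<in> arcs S" "iso_arcs h a = iso_arcs h b"
        then have ab: "a \<in> arcs G" "b \<in> arcs G"
          and "g (tail G a) = g (tail G b)" "g (head G a) = g (head G b)"
          and "tail G a \<in> f ` pverts H" "tail G b \<in> f ` pverts H"
            "head G a \<in> f ` pverts H" "head G b \<in> f ` pverts H"
          by (simp_all add: sel h_def)
        then have "tail G a = tail G b" "head G a = head G b"
          by (simp_all add: inj_on_eq_iff[OF ginj])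
        then show "a = b" using ab by (intro G.no_multi_arcs) (simp_all add: arc_to_ends_def)
      qed
    qed (use wf ginj in \<open>auto simp: h_def sel\<close>)
    moreover have "with_proj H = app_iso h S"
    proof -
      have "parcs H = iso_arcs h ` arcs S"
      proof (intro equalityI subrelI subsetI)
        fix u v assume uv: "(u, v) \<in> parcs H"
        then have V: "u \<in> pverts H" "v \<in> pverts H" by (auto dest: H.wellformed)
        with uv adj have "f u \<rightarrow>\<^bsub>G\<^esub> f v" by simp
        then obtain a where "a \<in> arcs G" "tail G a = f u" "head G a = f v" by (rule reachableE)
        with V show "(u, v) \<in> iso_arcs h ` arcs S"
          by (auto simp: sel h_def gf intro!: image_eqI[of _ _ a])
      next
        fix e assume "e \<in> iso_arcs h ` arcs S"
        then obtain a u v where a: "a \<in> arcs G" "tail G a = f u" "head G a = f v"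
          and V: "u \<in> pverts H" "v \<in> pverts H" and e: "e = (u, v)"
          by (auto simp: sel h_def gf)
        have "f u \<rightarrow>\<^bsub>G\<^esub> f v" using a by (force simp: arcs_ends_conv)
        with V adj e show "e \<in> parcs H" by simp
      qed
      moreover have "pverts H = g ` f ` pverts H" by (force simp: gf)
      ultimately show ?thesis by (simp add: app_iso_def with_proj_def h_def sel)
    qed
    ultimately show ?thesis using ind by (auto simp: digraph_iso_def)
  qed
  have "(\<exists>S. induced_subgraph S G \<and> digraph_iso S (with_proj H)) \<longleftrightarrow> ?R"
  proof
    assume "\<exists>S. induced_subgraph S G \<and> digraph_iso S (with_proj H)"
    then show ?R using 1 by (elim exE conjE)
  next
    assume ?R
    then show "\<exists>S. induced_subgraph S G \<and> digraph_iso S (with_proj H)"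
      by (elim exE conjE) (rule 2)
  qed
  then show ?thesis by (simp only: induced_free_def)
qed

lemma chromatic_number_attained:
  assumes "graph G"
  shows "\<exists>c. proper_coloring G (chromatic_number G) c"
proof -
  interpret graph G by fact
  obtain c where c: "bij_betw c (verts G) {0..<card (verts G)}"
    using ex_bij_betw_finite_nat[OF finite_verts] by blast
  have "proper_coloring G (card (verts G)) c"
    unfolding proper_coloring_def
  proof (intro conjI ballI allI impI)
    fix v assume "v \<in> verts G"
    then show "c v < card (verts G)" using c by (auto simp: bij_betw_def)
  next
    fix u v assume uv: "u \<rightarrow>\<^bsub>G\<^esub> v"
    then have "u \<noteq> v" using adj_not_same by blast
    then show "c u \<noteq> c v"
      using c adj_in_verts[OF uv] by (auto simp: bij_betw_def inj_on_def)
  qed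
  then show ?thesis
    unfolding chromatic_number_def
    using LeastI_ex[of "\<lambda>k. \<exists>c. proper_coloring G k c"] by blast
qed

end

theory Submission
  imports Defs
begin

text \<open>
  For an edge \<open>uv\<close>, the common non-neighbours of \<open>u\<close> and \<open>v\<close> induce no \<open>P\<^sub>3\<close>, hence a disjoint
  union of cliques, and the common neighbours are independent. Given a triangle \<open>abc\<close>, every vertex
  is a common neighbour or a common non-neighbour of two of \<open>a\<close>, \<open>b\<close>, \<open>c\<close>, so the vertices are
  covered by three independent sets and three disjoint unions of cliques. If no edge is anticomplete
  to a triangle, the cliques have at most two vertices and \<open>3 * 1 + 3 * 2 = 9\<close> colours suffice.
  If an edge \<open>xy\<close> is anticomplete to \<open>abc\<close>, each vertex whose only neighbour in \<open>abc\<close> is \<open>b\<close> is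
  adjacent to both \<open>x\<close> and \<open>y\<close>, so these vertices are independent, and likewise for \<open>c\<close>; then
  \<open>3 * 1 + 3 + 2 * 1 = 8\<close> colours suffice.
\<close>

section \<open>Colouring vertex sets of a relation\<close>

definition colorable_on :: "('a \<Rightarrow> 'a \<Rightarrow> bool) \<Rightarrow> 'a set \<Rightarrow> nat \<Rightarrow> bool" where
  "colorable_on E S k \<longleftrightarrow>
     (\<exists>c :: 'a \<Rightarrow> nat. (\<forall>v \<in> S. c v < k) \<and> (\<forall>u \<in> S. \<forall>v \<in> S. E u v \<longrightarrow> c u \<noteq> c v))"

lemma colorable_on_mono:
  assumes "colorable_on E T j" "S \<subseteq> T" "j \<le> k"
  shows "colorable_on E S k"
proof -
  from assms(1) obtain c where "\<And>v. v \<in> T \<Longrightarrow> c v < j"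
    "\<And>u v. u \<in> T \<Longrightarrow> v \<in> T \<Longrightarrow> E u v \<Longrightarrow> c u \<noteq> c v"
    unfolding colorable_on_def by blast
  with assms(2,3) have "\<forall>v \<in> S. c v < k" "\<forall>u \<in> S. \<forall>v \<in> S. E u v \<longrightarrow> c u \<noteq> c v"
    by (blast intro: order_less_le_trans)+
  then show ?thesis unfolding colorable_on_def by blast
qed

lemma colorable_on_Un:
  assumes "colorable_on E S j" "colorable_on E T k"
  shows "colorable_on E (S \<union> T) (j + k)"
proof -
  from assms obtain c d
    where c: "\<And>v. v \<in> S \<Longrightarrow> c v < j" "\<And>u v. u \<in> S \<Longrightarrow> v \<in> S \<Longrightarrow> E u v \<Longrightarrow> c u \<noteq> c v"
      and d: "\<And>v. v \<in> T \<Longrightarrow> d v < k" "\<And>u v. u \<in> T \<Longrightarrow> v \<in> T \<Longrightarrow> E u v \<Longrightarrow> d u \<noteq> d v"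
    unfolding colorable_on_def by blast
  \<comment> \<open>\<open>S\<close> and \<open>T\<close> may overlap: \<open>c\<close> takes
    precedence on the overlap, and the shift by \<open>j\<close> keeps the two palettes
    apart.\<close>
  define e where "e v = (if v \<in> S then c v else j + d v)" for v
  have "\<forall>v \<in> S \<union> T. e v < j + k"
    using c(1) d(1) by (auto simp: e_def intro: trans_less_add1)
  moreover have "e u \<noteq> e v" if "u \<in> S \<union> T" "v \<in> S \<union> T" "E u v" for u v
    using that c(2)[of u v] d(2)[of u v] c(1)[of u] c(1)[of v]
    by (auto simp: e_def split: if_splits)
  ultimately show ?thesis unfolding colorable_on_def by blast
qed

lemma colorable_on_independent:
  assumes "\<And>u v. u \<in> S \<Longrightarrow> v \<in> S \<Longrightarrow> \<not> E u v"
  shows "colorable_on E S 1"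
  unfolding colorable_on_def using assms by (intro exI[of _ "\<lambda>_. 0"]) auto

text \<open>By \<open>trans\<close>, adjacency within \<open>S\<close> is an equivalence up to the
  diagonal, so the components of \<open>S\<close> are cliques. Ordering the vertices by
  \<open>f\<close> and counting earlier neighbours numbers each clique from 0.\<close>

lemma colorable_on_disjoint_cliques:
  assumes fin: "finite S"
    and sym: "\<And>u v. E u v \<Longrightarrow> E v u"
    and irrefl: "\<And>v. \<not> E v v"
    and trans: "\<And>u v w. \<lbrakk>u \<in> S; v \<in> S; w \<in> S; E u v; E v w; u \<noteq> w\<rbrakk> \<Longrightarrow> E u w"
    and clique: "\<And>T. \<lbrakk>T \<subseteq> S; \<And>u v. \<lbrakk>u \<in> T; v \<in> T; u \<noteq> v\<rbrakk> \<Longrightarrow> E u v\<rbrakk> \<Longrightarrow> card T \<le> k"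
  shows "colorable_on E S k"
proof -
  obtain f :: "'a \<Rightarrow> nat" where f: "inj_on f S"
    using finite_imp_inj_to_nat_seg[OF fin] by blast
  \<comment> \<open>the colour of a vertex is its rank within its clique\<close>
  define B where "B v = {u \<in> S. E u v \<and> f u < f v}" for v
  have finB: "finite (B v)" for v using fin by (simp add: B_def)
  have "card (B v) < k" if v: "v \<in> S" for v
  proof -
    \<comment> \<open>Counting \<open>v\<close> itself in the clique makes its rank strictly smaller
      than \<open>k\<close>.\<close>
    have "card (insert v (B v)) \<le> k"
    proof (rule clique)
      show "insert v (B v) \<subseteq> S" using v by (auto simp: B_def)
      show "E x y" if "x \<in> insert v (B v)" "y \<in> insert v (B v)" "x \<noteq> y" for x y
        using that v sym[of x v] sym[of y v] trans[of x v y] by (auto simp: B_def)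
    qed
    moreover have "v \<notin> B v" by (simp add: B_def)
    ultimately show ?thesis using finB by simp
  qed
  \<comment> \<open>Earlier neighbours of \<open>u\<close> are also earlier neighbours of
    \<open>v\<close>, and \<open>u\<close> lies in \<open>B v\<close> but not in
    \<open>B u\<close>.\<close>
  moreover have less: "card (B u) < card (B v)"
    if "u \<in> S" "v \<in> S" "E u v" "f u < f v" for u v
  proof (rule psubset_card_mono[OF finB])
    have "E x v" if "x \<in> B u" for x
      using that \<open>u \<in> S\<close> \<open>v \<in> S\<close> \<open>E u v\<close> \<open>f u < f v\<close> trans[of x u v]
      by (cases "x = v") (auto simp: B_def)
    then show "B u \<subset> B v" using that by (auto simp: B_def)
  qed
  moreover have "card (B u) \<noteq> card (B v)" if "u \<in> S" "v \<in> S" "E u v" for u v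
  proof -
    have "f u \<noteq> f v" using f that irrefl by (metis inj_onD)
    then show ?thesis
      using less[of u v] less[of v u] that sym[of u v] by (cases "f u < f v") auto
  qed
  ultimately show ?thesis
    unfolding colorable_on_def by (intro exI[of _ "\<lambda>v. card (B v)"]) blast
qed

section \<open>Neighbourhoods of an edge\<close>

text \<open>Only \<open>a \<noteq> c\<close> is required in \<open>no_p3p2\<close>: if
  \<open>d\<close> or \<open>e\<close> equals one of \<open>a\<close>, \<open>b\<close>,
  \<open>c\<close>, symmetry makes the conclusion true. In \<open>no_k4\<close>, irreflexivity makes
  the four vertices distinct.\<close>

locale p3p2_k4_free =
  fixes V :: "'a set" and E :: "'a \<Rightarrow> 'a \<Rightarrow> bool"
  assumes finite_V: "finite V"
    and E_in_V: "E u v \<Longrightarrow> u \<in> V"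
    and E_sym: "E u v \<Longrightarrow> E v u"
    and E_irrefl: "\<not> E v v"
    and no_p3p2: "\<lbrakk>E a b; E b c; a \<noteq> c; \<not> E a c; E d e\<rbrakk> \<Longrightarrow>
      E a d \<or> E a e \<or> E b d \<or> E b e \<or> E c d \<or> E c e"
    and no_k4: "\<lbrakk>E a b; E a c; E a d; E b c; E b d; E c d\<rbrakk> \<Longrightarrow> False"
begin

definition common_nonnbrs :: "'a \<Rightarrow> 'a \<Rightarrow> 'a set" where
  "common_nonnbrs u v = {x \<in> V. \<not> E x u \<and> \<not> E x v}"

definition common_nbrs :: "'a \<Rightarrow> 'a \<Rightarrow> 'a set" where
  "common_nbrs u v = {x. E x u \<and> E x v}"

lemma finite_common_nonnbrs: "finite (common_nonnbrs u v)"
  using finite_V by (simp add: common_nonnbrs_def)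

text \<open>Otherwise \<open>x\<close>, \<open>y\<close>, \<open>z\<close> would form an induced
  \<open>P\<^sub>3\<close> anticomplete to the edge \<open>uv\<close>.\<close>

lemma common_nonnbrs_trans:
  assumes "E u v" "x \<in> common_nonnbrs u v" "y \<in> common_nonnbrs u v" "z \<in> common_nonnbrs u v"
    and "E x y" "E y z" "x \<noteq> z"
  shows "E x z"
  using assms no_p3p2[of x y z u v] unfolding common_nonnbrs_def by blast

lemma colorable_common_nbrs:
  assumes "E u v"
  shows "colorable_on E (common_nbrs u v) 1"
proof (rule colorable_on_independent)
  show "\<not> E x y" if "x \<in> common_nbrs u v" "y \<in> common_nbrs u v" for x y
    using that assms no_k4[of x y u v] unfolding common_nbrs_def by blast
qed

text \<open>The cliques of this set have at most three vertices because four would form a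
  \<open>K\<^sub>4\<close>.\<close>

lemma colorable_common_nonnbrs:
  assumes uv: "E u v"
  shows "colorable_on E (common_nonnbrs u v) 3"
proof (rule colorable_on_disjoint_cliques[OF finite_common_nonnbrs E_sym E_irrefl
      common_nonnbrs_trans[OF uv]])
  fix T assume T: "T \<subseteq> common_nonnbrs u v" "\<And>x y. \<lbrakk>x \<in> T; y \<in> T; x \<noteq> y\<rbrakk> \<Longrightarrow> E x y"
  show "card T \<le> 3"
  proof (rule ccontr)
    assume "\<not> card T \<le> 3"
    then have "4 \<le> card T" by simp
    then obtain T' where T': "T' \<subseteq> T" "card T' = Suc 3"
      by (metis obtain_subset_with_card_n Suc_numeral semiring_norm(2,8))
    then obtain d A where A: "T' = insert d A" "d \<notin> A" "card A = 3"
      by (metis card_Suc_eq)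
    then obtain a b c where "A = {a, b, c}" "a \<noteq> b" "a \<noteq> c" "b \<noteq> c"
      by (auto simp: card_3_iff)
    with T' A have "a \<in> T" "b \<in> T" "c \<in> T" "d \<in> T" "a \<noteq> d" "b \<noteq> d" "c \<noteq> d" by auto
    then show False
      using T(2) no_k4[of a b c d] \<open>a \<noteq> b\<close> \<open>a \<noteq> c\<close> \<open>b \<noteq> c\<close> by blast
  qed
qed

lemma colorable_common_nonnbrs_triangle_free:
  assumes uv: "E u v"
    and tf: "\<And>x y z. \<lbrakk>x \<in> common_nonnbrs u v; y \<in> common_nonnbrs u v; z \<in> common_nonnbrs u v;
      E x y; E x z; E y z\<rbrakk> \<Longrightarrow> False"
  shows "colorable_on E (common_nonnbrs u v) 2"
proof (rule colorable_on_disjoint_cliques[OF finite_common_nonnbrs E_sym E_irrefl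
      common_nonnbrs_trans[OF uv]])
  fix T assume T: "T \<subseteq> common_nonnbrs u v" "\<And>x y. \<lbrakk>x \<in> T; y \<in> T; x \<noteq> y\<rbrakk> \<Longrightarrow> E x y"
  show "card T \<le> 2"
  proof (rule ccontr)
    assume "\<not> card T \<le> 2"
    then have "3 \<le> card T" by simp
    then obtain T' where T': "T' \<subseteq> T" "card T' = 3"
      by (metis obtain_subset_with_card_n)
    then obtain a b c where "T' = {a, b, c}" "a \<noteq> b" "a \<noteq> c" "b \<noteq> c"
      by (auto simp: card_3_iff)
    with T' have "a \<in> T" "b \<in> T" "c \<in> T" by auto
    then show False
      using T tf[of a b c] \<open>a \<noteq> b\<close> \<open>a \<noteq> c\<close> \<open>b \<noteq> c\<close> by blast
  qed
qed

section \<open>Colouring from a triangle\<close>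

text \<open>Pigeonhole: of the three truth values \<open>E x a\<close>, \<open>E x b\<close>,
  \<open>E x c\<close>, two agree.\<close>

lemma triangle_cover:
  "V \<subseteq> common_nonnbrs a b \<union> common_nonnbrs a c \<union> common_nonnbrs b c \<union>
    (common_nbrs a b \<union> common_nbrs a c \<union> common_nbrs b c)"
  by (auto simp: common_nonnbrs_def common_nbrs_def)

lemma colorable_triangle_common_nbrs:
  assumes "E a b" "E a c" "E b c"
  shows "colorable_on E (common_nbrs a b \<union> common_nbrs a c \<union> common_nbrs b c) 3"
  using colorable_on_Un[OF colorable_on_Un[OF colorable_common_nbrs[OF assms(1)]
    colorable_common_nbrs[OF assms(2)]] colorable_common_nbrs[OF assms(3)]]
  by (simp add: numeral_3_eq_3)

text \<open>The set difference consists of the vertices whose only neighbour in the triangle is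
  \<open>b\<close>. Each is adjacent to both ends of \<open>xy\<close>, so an edge between two of
  them would complete a \<open>K\<^sub>4\<close> with \<open>x\<close> and \<open>y\<close>.\<close>

lemma colorable_private_nbrs:
  assumes abc: "E a b" "E a c" "E b c"
    and xy: "E x y" "\<not> E x a" "\<not> E x b" "\<not> E x c" "\<not> E y a" "\<not> E y b" "\<not> E y c"
  shows "colorable_on E (common_nonnbrs a c - common_nonnbrs b c) 1"
proof (rule colorable_on_independent)
  have V: "x \<in> common_nonnbrs a c" "y \<in> common_nonnbrs a c"
    using xy E_in_V[OF xy(1)] E_in_V[OF E_sym[OF xy(1)]] by (simp_all add: common_nonnbrs_def)
  have adj: "E n x \<and> E n y" if n: "n \<in> common_nonnbrs a c - common_nonnbrs b c" for n
  proof -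
    have "E n b" "\<not> E n a" "\<not> E n c" "n \<noteq> a" using n abc by (auto simp: common_nonnbrs_def)
    \<comment> \<open>The path \<open>n\<close>, \<open>b\<close>, \<open>a\<close> is an induced
      \<open>P\<^sub>3\<close>, and \<open>xy\<close> has no edge to \<open>b\<close> or
      \<open>a\<close>.\<close>
    then have "E n x \<or> E n y"
      using no_p3p2[of n b a x y] abc xy E_sym by blast
    moreover have "n \<noteq> x" "n \<noteq> y" using \<open>E n b\<close> xy by auto
    \<comment> \<open>All of \<open>n\<close>, \<open>x\<close>, \<open>y\<close> lie in
      \<open>common_nonnbrs a c\<close>, where adjacency is transitive, so one edge from
      \<open>n\<close> to \<open>xy\<close> forces the other.\<close>
    ultimately show ?thesis
      using common_nonnbrs_trans[OF \<open>E a c\<close>, of n x y] common_nonnbrs_trans[OF \<open>E a c\<close>, of n y x]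
        n V xy(1) E_sym by blast
  qed
  show "\<not> E m n" if "m \<in> common_nonnbrs a c - common_nonnbrs b c"
    "n \<in> common_nonnbrs a c - common_nonnbrs b c" for m n
    using adj[OF that(1)] adj[OF that(2)] no_k4[of m n x y] xy(1) by blast
qed

lemma colorable_if_anticomplete_edge:
  assumes abc: "E a b" "E a c" "E b c"
    and xy: "E x y" "\<not> E x a" "\<not> E x b" "\<not> E x c" "\<not> E y a" "\<not> E y b" "\<not> E y c"
  shows "colorable_on E V 8"
proof -
  have "colorable_on E (common_nonnbrs a c - common_nonnbrs b c) 1"
    using abc xy by (rule colorable_private_nbrs)
  \<comment> \<open>Exchanging \<open>b\<close> and \<open>c\<close> treats the vertices whose only
    neighbour in the triangle is \<open>c\<close>.\<close>
  moreover have "common_nonnbrs c b = common_nonnbrs b c"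
    by (auto simp: common_nonnbrs_def)
  with colorable_private_nbrs[OF abc(2) abc(1) E_sym[OF abc(3)] xy(1,2,4,3,5,7,6)]
  have "colorable_on E (common_nonnbrs a b - common_nonnbrs b c) 1" by simp
  \<comment> \<open>Only \<open>common_nonnbrs b c\<close> is kept whole, at 3 colours; removing it
    from the other two sets leaves independent sets.\<close>
  ultimately have "colorable_on E ((common_nonnbrs a c - common_nonnbrs b c) \<union>
      (common_nonnbrs a b - common_nonnbrs b c) \<union> common_nonnbrs b c \<union>
      (common_nbrs a b \<union> common_nbrs a c \<union> common_nbrs b c)) (1 + 1 + 3 + 3)"
    by (intro colorable_on_Un colorable_common_nonnbrs[OF \<open>E b c\<close>]
      colorable_triangle_common_nbrs[OF abc])
  then show ?thesis
    by (rule colorable_on_mono) (use triangle_cover[of a b c] in auto)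
qed

lemma colorable_if_no_anticomplete_edge:
  assumes abc: "E a b" "E a c" "E b c"
    and no_edge: "\<And>x y z u v. \<lbrakk>E x y; E x z; E y z; E u v\<rbrakk> \<Longrightarrow>
      E x u \<or> E x v \<or> E y u \<or> E y v \<or> E z u \<or> E z v"
  shows "colorable_on E V 9"
proof -
  have "colorable_on E (common_nonnbrs u v) 2" if "E u v" for u v
    using that
  proof (rule colorable_common_nonnbrs_triangle_free)
    show False if "x \<in> common_nonnbrs u v" "y \<in> common_nonnbrs u v" "z \<in> common_nonnbrs u v"
      "E x y" "E x z" "E y z" for x y z
      using that no_edge[of x y z u v] \<open>E u v\<close> unfolding common_nonnbrs_def by blast
  qed
  then have "colorable_on E (common_nonnbrs a b \<union> common_nonnbrs a c \<union> common_nonnbrs b c \<union>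
    (common_nbrs a b \<union> common_nbrs a c \<union> common_nbrs b c)) (2 + 2 + 2 + 3)"
    using abc by (intro colorable_on_Un colorable_triangle_common_nbrs)
  then show ?thesis
    by (rule colorable_on_mono) (use triangle_cover[of a b c] in auto)
qed

text \<open>Here neighbourhoods are independent, so for an edge \<open>uv\<close> one colour for
  each end's neighbourhood and two for the common non-neighbours suffice.\<close>

lemma colorable_if_triangle_free:
  assumes tf: "\<And>x y z. \<lbrakk>E x y; E x z; E y z\<rbrakk> \<Longrightarrow> False"
  shows "colorable_on E V 4"
proof (cases "\<exists>u v. E u v")
  case False
  then have "colorable_on E V 1" by (intro colorable_on_independent) blast
  then show ?thesis by (rule colorable_on_mono) auto
next
  case True
  then obtain u v where uv: "E u v" by blast
  have nbrs: "colorable_on E {x. E x w} 1" for w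
    using tf by (intro colorable_on_independent) blast
  have "colorable_on E (common_nonnbrs u v \<union> {x. E x u} \<union> {x. E x v}) (2 + 1 + 1)"
    using uv tf
    by (intro colorable_on_Un nbrs colorable_common_nonnbrs_triangle_free) blast+
  then show ?thesis
    by (rule colorable_on_mono) (auto simp: common_nonnbrs_def)
qed

lemma colorable_9: "colorable_on E V 9"
proof (cases "\<exists>x y z. E x y \<and> E x z \<and> E y z")
  case False
  then have "colorable_on E V 4" by (intro colorable_if_triangle_free) blast
  then show ?thesis by (rule colorable_on_mono) auto
next
  case True
  then obtain a b c where abc: "E a b" "E a c" "E b c" by blast
  show ?thesis
  \<comment> \<open>The split ranges over all triangles, not just \<open>abc\<close>: the
    9-colouring must exclude every triangle among the common non-neighbours of an edge, and the
    8-colouring starts from whichever triangle has an anticomplete edge.\<close>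
  proof (cases "\<exists>x y z u v. E x y \<and> E x z \<and> E y z \<and> E u v \<and>
      \<not> (E x u \<or> E x v \<or> E y u \<or> E y v \<or> E z u \<or> E z v)")
    case True
    then obtain x y z u v where "E x y" "E x z" "E y z" "E u v"
      "\<not> E x u" "\<not> E x v" "\<not> E y u" "\<not> E y v" "\<not> E z u" "\<not> E z v" by blast
    then have "colorable_on E V 8"
      using colorable_if_anticomplete_edge[of x y z u v] E_sym by blast
    then show ?thesis by (rule colorable_on_mono) auto
  next
    case False
    show ?thesis
      using abc by (rule colorable_if_no_anticomplete_edge) (use False in blast)
  qed
qed

end

section \<open>Transfer to induced subgraphs and the chromatic number\<close>

lemma p3p2_k4_free_if_induced_free:
  assumes "graph G"
    and p3p2: "induced_free G (with_proj (disjoint_union (path_graph 3) (path_graph 2)))"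
    and k4: "induced_free G (with_proj (complete_graph 4))"
  shows "p3p2_k4_free (verts G) (\<lambda>u v. u \<rightarrow>\<^bsub>G\<^esub> v)"
proof -
  interpret graph G by fact
  have sym: "v \<rightarrow>\<^bsub>G\<^esub> u" if "u \<rightarrow>\<^bsub>G\<^esub> v" for u v
    using arcs_ends_symmetric[OF sym_arcs that] .
  have irrefl: "\<not> v \<rightarrow>\<^bsub>G\<^esub> v" for v using adj_not_same by blast
  have lt: "n < 2 \<longleftrightarrow> n = 0 \<or> n = 1" "n < 3 \<longleftrightarrow> n = 0 \<or> n = 1 \<or> n = 2"
    "n < 4 \<longleftrightarrow> n = 0 \<or> n = 1 \<or> n = 2 \<or> n = 3" for n :: nat by auto
  show ?thesis
  proof
    show "finite (verts G)" by simp
    show "u \<in> verts G" if "u \<rightarrow>\<^bsub>G\<^esub> v" for u v using adj_in_verts[OF that] by simp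
  next
    fix a b c d e
    assume edges: "a \<rightarrow>\<^bsub>G\<^esub> b" "b \<rightarrow>\<^bsub>G\<^esub> c" "a \<noteq> c" "\<not> a \<rightarrow>\<^bsub>G\<^esub> c" "d \<rightarrow>\<^bsub>G\<^esub> e"
    show "a \<rightarrow>\<^bsub>G\<^esub> d \<or> a \<rightarrow>\<^bsub>G\<^esub> e \<or> b \<rightarrow>\<^bsub>G\<^esub> d \<or> b \<rightarrow>\<^bsub>G\<^esub> e \<or> c \<rightarrow>\<^bsub>G\<^esub> d \<or> c \<rightarrow>\<^bsub>G\<^esub> e"
    proof (rule ccontr)
      assume non: "\<not> ?thesis"
      define H where "H = disjoint_union (path_graph 3) (path_graph 2)"
      define f where "f = case_sum (\<lambda>i::nat. if i = 0 then a else if i = 1 then b else c)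
        (\<lambda>i::nat. if i = 0 then d else e)"
      have pv: "pverts H = {Inl 0, Inl 1, Inl 2, Inr 0, Inr 1}"
        by (auto simp: H_def disjoint_union_def path_graph_def lt)
      have pa: "parcs H = {(Inl 0, Inl 1), (Inl 1, Inl 0), (Inl 1, Inl 2), (Inl 2, Inl 1),
          (Inr 0, Inr 1), (Inr 1, Inr 0)}"
        by (force simp: H_def disjoint_union_def path_graph_def lt image_iff)
      have rev: "b \<rightarrow>\<^bsub>G\<^esub> a" "c \<rightarrow>\<^bsub>G\<^esub> b" "e \<rightarrow>\<^bsub>G\<^esub> d" "\<not> c \<rightarrow>\<^bsub>G\<^esub> a"
        "\<not> d \<rightarrow>\<^bsub>G\<^esub> a" "\<not> d \<rightarrow>\<^bsub>G\<^esub> b" "\<not> d \<rightarrow>\<^bsub>G\<^esub> c" "\<not> e \<rightarrow>\<^bsub>G\<^esub> a" "\<not> e \<rightarrow>\<^bsub>G\<^esub> b" "\<not> e \<rightarrow>\<^bsub>G\<^esub> c"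
        using edges non sym by blast+
      \<comment> \<open>A coincidence such as \<open>a = d\<close> would turn the edge
        \<open>de\<close> into an edge from \<open>a\<close> to \<open>e\<close>, contradicting
        \<open>non\<close>.\<close>
      have "distinct [a, b, c, d, e]" using edges rev non irrefl by auto
      then have "inj_on f (pverts H)" by (auto simp: pv f_def)
      moreover have "f ` pverts H \<subseteq> verts G"
        using adj_in_verts edges by (auto simp: pv f_def)
      moreover have "\<forall>u \<in> pverts H. \<forall>v \<in> pverts H. (u, v) \<in> parcs H \<longleftrightarrow> f u \<rightarrow>\<^bsub>G\<^esub> f v"
        using edges rev non irrefl by (simp add: pv pa f_def)
      moreover have "pair_graph H"
        unfolding H_def by (intro pair_graph_disjoint_union pair_graph_path_graph)
      ultimately show False
        using induced_free_iff[OF \<open>graph G\<close>, of H] p3p2 unfolding H_def by blast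
    qed
  next
    fix a b c d
    assume edges: "a \<rightarrow>\<^bsub>G\<^esub> b" "a \<rightarrow>\<^bsub>G\<^esub> c" "a \<rightarrow>\<^bsub>G\<^esub> d" "b \<rightarrow>\<^bsub>G\<^esub> c" "b \<rightarrow>\<^bsub>G\<^esub> d" "c \<rightarrow>\<^bsub>G\<^esub> d"
    define f where "f i = (if i = 0 then a else if i = 1 then b else if i = 2 then c else d)"
      for i :: nat
    have pv: "pverts (complete_graph 4) = {0, 1, 2, 3}"
      by (auto simp: complete_graph_def lt)
    have rev: "b \<rightarrow>\<^bsub>G\<^esub> a" "c \<rightarrow>\<^bsub>G\<^esub> a" "d \<rightarrow>\<^bsub>G\<^esub> a" "c \<rightarrow>\<^bsub>G\<^esub> b" "d \<rightarrow>\<^bsub>G\<^esub> b" "d \<rightarrow>\<^bsub>G\<^esub> c"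
      using edges sym by blast+
    have "distinct [a, b, c, d]" using edges irrefl by auto
    then have "inj_on f (pverts (complete_graph 4))" by (auto simp: pv f_def)
    moreover have "f ` pverts (complete_graph 4) \<subseteq> verts G"
      using adj_in_verts edges by (auto simp: pv f_def)
    moreover have "\<forall>u \<in> pverts (complete_graph 4). \<forall>v \<in> pverts (complete_graph 4).
        (u, v) \<in> parcs (complete_graph 4) \<longleftrightarrow> f u \<rightarrow>\<^bsub>G\<^esub> f v"
      unfolding pv using edges rev irrefl by (simp add: complete_graph_def f_def)
    ultimately show False
      using induced_free_iff[OF \<open>graph G\<close> pair_graph_complete_graph] k4 by blast
  qed (use sym irrefl in blast)+
qed

theorem theorem1p6:
  fixes G :: "('a, 'b) pre_digraph"
  assumes "graph G"
    and "induced_free G (with_proj (disjoint_union (path_graph 3) (path_graph 2)))"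
    and "induced_free G (with_proj (complete_graph 4))"
  shows "chromatic_number G \<le> 9"
proof -
  interpret graph G by fact
  obtain c where "\<forall>v \<in> verts G. c v < (9 :: nat)"
    and "\<forall>u \<in> verts G. \<forall>v \<in> verts G. u \<rightarrow>\<^bsub>G\<^esub> v \<longrightarrow> c u \<noteq> c v"
    using p3p2_k4_free.colorable_9[OF p3p2_k4_free_if_induced_free[OF assms]]
    unfolding colorable_on_def by blast
  then have "proper_coloring G 9 c"
    unfolding proper_coloring_def using adj_in_verts by blast
  then show ?thesis
    unfolding chromatic_number_def by (intro Least_le) blast
qed

end
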